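(* Let $U$ be an almost upper-triangular transition matrix, irreducible on $\mathbb N$. For $n\ge 0$ let $U^{(n)}$ be the projected transition matrix on $[0,n]$ defined by $$U^{(n)}_{i,j}=U_{i,j}\ \ (i\in[0,n],\,j\in[0,n-1]),\qquad U^{(n)}_{i,n}=\sum_{j\ge n}U_{i,j}\ \ (i\in[0,n]),$$ and let $\rho^{(n)}$ be the unique invariant probability distribution of $U^{(n)}$. (i) $U$ admits a measure $\pi$ on $\mathbb{N}$ (non-negative, total mass in $(0,+\infty]$) as an invariant measure if and only if there exists a sequence $(c_n,n\ge0)$ such that $c_n\rho^{(n)}\to\pi$ weakly. (ii) For a probability distribution $\rho$ on $\mathbb{N}$: $U$ is positive recurrent with invariant probability distribution $\rho$ if and only if $\rho^{(n)}\to\rho$ weakly.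
   Context: $\mathbb N=\{0,1,2,\dots\}$, $[a,b]$ denotes an integer interval. A transition matrix $U=[U_{i,j}]_{i,j\ge0}$ (non-negative entries, rows summing to $1$) is almost upper-triangular if $U_{i,j}>0\Rightarrow j\ge i-1$. A measure $\pi$ is invariant by $U$ if $\sum_a\pi_aU_{a,b}=\pi_b$ for all $b$. A sequence of measures $\pi^{(n)}$ on $\mathbb N$ converges weakly to a measure $\pi$ on $\mathbb{N}$ if $\lim_n\pi^{(n)}_k=\pi_k$ for all $k\ge0$; measures on $[0,n]$ are viewed as measures on $\mathbb N$ (zero outside $[0,n]$). *)

theory Defs
  imports Complex_Main "HOL-Library.Extended_Nonnegative_Real"
begin

text \<open>
  Matrices indexed by the natural numbers are functions of type \<open>nat \<Rightarrow> nat \<Rightarrow> real\<close>; a measure on the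
  natural numbers is given by its point masses, as a function of type \<open>nat \<Rightarrow> real\<close>.
\<close>

definition transition_matrix :: "(nat \<Rightarrow> nat \<Rightarrow> real) \<Rightarrow> bool" where
  "transition_matrix U \<longleftrightarrow> (\<forall>i j. 0 \<le> U i j) \<and> (\<forall>i. (\<lambda>j. U i j) sums 1)"

text \<open>The condition \<open>j \<ge> i - 1\<close> is written as \<open>i \<le> j + 1\<close> to avoid truncated subtraction.\<close>

definition almost_upper_triangular :: "(nat \<Rightarrow> nat \<Rightarrow> real) \<Rightarrow> bool" where
  "almost_upper_triangular U \<longleftrightarrow> (\<forall>i j. U i j > 0 \<longrightarrow> i \<le> j + 1)"

primrec matrix_power :: "(nat \<Rightarrow> nat \<Rightarrow> real) \<Rightarrow> nat \<Rightarrow> nat \<Rightarrow> nat \<Rightarrow> real" where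
  "matrix_power U 0 i j = (if i = j then 1 else 0)"
| "matrix_power U (Suc n) i j = (\<Sum>k. U i k * matrix_power U n k j)"

definition irreducible_chain :: "(nat \<Rightarrow> nat \<Rightarrow> real) \<Rightarrow> bool" where
  "irreducible_chain U \<longleftrightarrow> (\<forall>i j. \<exists>n. matrix_power U n i j > 0)"

definition nonzero_measure :: "(nat \<Rightarrow> real) \<Rightarrow> bool" where
  "nonzero_measure \<pi> \<longleftrightarrow> (\<forall>k. 0 \<le> \<pi> k) \<and> 0 < (\<Sum>k. ennreal (\<pi> k))"

definition prob_distribution :: "(nat \<Rightarrow> real) \<Rightarrow> bool" where
  "prob_distribution \<rho> \<longleftrightarrow> (\<forall>k. 0 \<le> \<rho> k) \<and> \<rho> sums 1"

definition invariant_by :: "(nat \<Rightarrow> real) \<Rightarrow> (nat \<Rightarrow> nat \<Rightarrow> real) \<Rightarrow> bool" where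
  "invariant_by \<pi> U \<longleftrightarrow> (\<forall>b. (\<lambda>a. \<pi> a * U a b) sums \<pi> b)"

definition converges_weakly :: "(nat \<Rightarrow> nat \<Rightarrow> real) \<Rightarrow> (nat \<Rightarrow> real) \<Rightarrow> bool" where
  "converges_weakly \<mu> \<pi> \<longleftrightarrow> (\<forall>k. (\<lambda>n. \<mu> n k) \<longlonglongrightarrow> \<pi> k)"

text \<open>
  \<open>first_passage U n i j\<close> is the probability that the chain started at \<open>i\<close> visits \<open>j\<close> at time \<open>n\<close>
  and at none of the times \<open>1, \<dots>, n - 1\<close>. For \<open>i = j\<close>, this is the law of the return time to \<open>i\<close>.
\<close>

fun first_passage :: "(nat \<Rightarrow> nat \<Rightarrow> real) \<Rightarrow> nat \<Rightarrow> nat \<Rightarrow> nat \<Rightarrow> real" where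
  "first_passage U 0 i j = 0"
| "first_passage U (Suc 0) i j = U i j"
| "first_passage U (Suc (Suc n)) i j =
     (\<Sum>k. if k = j then 0 else U i k * first_passage U (Suc n) k j)"

text \<open>From every state, the return time is almost surely finite and has finite expectation.\<close>

definition positive_recurrent :: "(nat \<Rightarrow> nat \<Rightarrow> real) \<Rightarrow> bool" where
  "positive_recurrent U \<longleftrightarrow>
     (\<forall>i. (\<lambda>n. first_passage U n i i) sums 1 \<and>
          summable (\<lambda>n. real n * first_passage U n i i))"

text \<open>The matrix \<open>U\<^sup>(\<^sup>n\<^sup>)\<close> on \<open>[0,n]\<close>, extended by zero outside \<open>[0,n] \<times> [0,n]\<close>.\<close>

definition projected_matrix :: "(nat \<Rightarrow> nat \<Rightarrow> real) \<Rightarrow> nat \<Rightarrow> nat \<Rightarrow> nat \<Rightarrow> real" where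
  "projected_matrix U n i j =
     (if i \<le> n \<and> j < n then U i j
      else if i \<le> n \<and> j = n then (\<Sum>k. U i (n + k))
      else 0)"

definition projected_invariant :: "(nat \<Rightarrow> nat \<Rightarrow> real) \<Rightarrow> nat \<Rightarrow> (nat \<Rightarrow> real) \<Rightarrow> bool" where
  "projected_invariant U n r \<longleftrightarrow>
     prob_distribution r \<and> (\<forall>k>n. r k = 0) \<and> invariant_by r (projected_matrix U n)"

text \<open>Existence and uniqueness are shown in \<open>projected_invariant_unique\<close> below.\<close>

definition projected_distribution :: "(nat \<Rightarrow> nat \<Rightarrow> real) \<Rightarrow> nat \<Rightarrow> nat \<Rightarrow> real" where
  "projected_distribution U n = (THE r. projected_invariant U n r)"

lemma subdiagonal_pos:
  assumes T: "transition_matrix U" and A: "almost_upper_triangular U" and I: "irreducible_chain U"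
  shows "U (Suc b) b > 0"
proof (rule ccontr)
  assume "\<not> U (Suc b) b > 0"
  moreover have nn: "U i j \<ge> 0" for i j using T by (simp add: transition_matrix_def)
  ultimately have z: "U (Suc b) b = 0" by (metis less_eq_real_def)
  have lower: "U i k = 0" if "i > Suc k" for i k
    using A nn[of i k] that unfolding almost_upper_triangular_def
    by (metis Suc_eq_plus1 less_eq_real_def not_le)
  have "\<forall>i j. i > b \<longrightarrow> j \<le> b \<longrightarrow> matrix_power U n i j = 0" for n
  proof (induction n)
    case 0
    then show ?case by auto
  next
    case (Suc n)
    have "U i k * matrix_power U n k j = 0" if "i > b" "j \<le> b" for i j k
    proof (cases "k > b")
      case True
      then show ?thesis using Suc that by simp
    next
      case False
      then have "i > Suc k \<or> (i = Suc b \<and> k = b)" using that by linarith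
      then show ?thesis using lower z by auto
    qed
    then show ?case by (simp del: mult_eq_0_iff)
  qed
  then have "matrix_power U n (Suc b) b = 0" for n by simp
  then show False using I unfolding irreducible_chain_def by (metis less_irrefl)
qed

lemma projected_invariant_unique:
  assumes T: "transition_matrix U" and A: "almost_upper_triangular U" and I: "irreducible_chain U"
  shows "\<exists>!r. projected_invariant U n r"
proof -
  have pos: "U (Suc b) b > 0" for b using subdiagonal_pos[OF assms] .
  have nn: "U i j \<ge> 0" for i j using T by (simp add: transition_matrix_def)
  have row: "U i sums 1" for i using T by (simp add: transition_matrix_def)
  have lower: "U i k = 0" if "i > Suc k" for i k
    using A nn[of i k] that unfolding almost_upper_triangular_def
    by (metis Suc_eq_plus1 less_eq_real_def not_le)
  have tail: "(\<Sum>k. U i (m + k)) = 1 - (\<Sum>j<m. U i j)" for i m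
    using suminf_minus_initial_segment[OF sums_summable[OF row[of i]], of m] sums_unique[OF row[of i]]
    by (simp add: add.commute)
  have part: "(\<Sum>j<m. U i j) \<le> 1" for i m
    using sum_le_suminf[OF sums_summable[OF row[of i]], of "{..<m}"] sums_unique[OF row[of i]] nn
    by auto
  have "\<exists>w. w 0 = 1 \<and> (\<forall>k. 0 \<le> w k) \<and>
          (\<forall>b<m. w (Suc b) * U (Suc b) b = (\<Sum>a\<le>b. w a * (1 - (\<Sum>j<Suc b. U a j))))" for m
  proof (induction m)
    case 0
    show ?case by (rule exI[of _ "\<lambda>_. 1"]) simp
  next
    case (Suc m)
    then obtain w where w: "w 0 = (1::real)" "\<forall>k. 0 \<le> w k"
      "\<forall>b<m. w (Suc b) * U (Suc b) b = (\<Sum>a\<le>b. w a * (1 - (\<Sum>j<Suc b. U a j)))" by blast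
    define s where "s = (\<Sum>a\<le>m. w a * (1 - (\<Sum>j<Suc m. U a j)))"
    have s: "s \<ge> 0" unfolding s_def
      by (intro sum_nonneg mult_nonneg_nonneg) (use w(2) part in \<open>simp_all del: sum.lessThan_Suc\<close>)
    define w' where "w' = w(Suc m := s / U (Suc m) m)"
    have eq: "w' k = w k" if "k \<le> m" for k using that by (simp add: w'_def)
    have "w' (Suc b) * U (Suc b) b = (\<Sum>a\<le>b. w' a * (1 - (\<Sum>j<Suc b. U a j)))" if "b < Suc m" for b
    proof -
      have R: "(\<Sum>a\<le>b. w' a * (1 - (\<Sum>j<Suc b. U a j))) = (\<Sum>a\<le>b. w a * (1 - (\<Sum>j<Suc b. U a j)))"
        by (rule sum.cong) (use that eq in auto)
      show ?thesis
      proof (cases "b = m")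
        case True
        then show ?thesis unfolding R using pos[of m] by (simp add: w'_def s_def)
      next
        case False
        then show ?thesis unfolding R using that w(3) eq[of "Suc b"] by simp
      qed
    qed
    moreover have "w' 0 = 1" "\<forall>k. 0 \<le> w' k" using w s pos[of m] by (auto simp: w'_def)
    ultimately show ?case by blast
  qed
  from this[of n] obtain w where w0: "w 0 = (1::real)" and wn: "\<And>k. 0 \<le> w k"
    and cut: "\<And>b. b < n \<Longrightarrow> w (Suc b) * U (Suc b) b = (\<Sum>a\<le>b. w a * (1 - (\<Sum>j<Suc b. U a j)))" by blast
  have C: "(\<Sum>a\<le>b. w a * (1 - (\<Sum>j<b. U a j))) = w b" if "b \<le> n" for b
  proof (cases b)
    case 0
    then show ?thesis by simp
  next
    case (Suc c)
    have "(\<Sum>j<Suc c. U (Suc c) j) = U (Suc c) c" using lower by simp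
    then show ?thesis using cut[of c] that Suc by (simp add: algebra_simps)
  qed
  have split: "(\<Sum>a\<le>n. x a * U a b) = (\<Sum>a\<le>b. x a * U a b) + x (Suc b) * U (Suc b) b"
    if "b < n" for b and x :: "nat \<Rightarrow> real"
  proof -
    have "(\<Sum>a\<le>n. x a * U a b) = (\<Sum>a\<le>Suc b. x a * U a b)"
      by (rule sum.mono_neutral_right) (use that lower in auto)
    then show ?thesis by simp
  qed
  have col: "(\<Sum>a\<le>n. w a * projected_matrix U n a b) = w b" if "b \<le> n" for b
  proof (cases "b = n")
    case True
    then show ?thesis using C[of n] by (simp add: projected_matrix_def tail)
  next
    case False
    then have b: "b < n" using that by simp
    have "w b = (\<Sum>a\<le>b. w a * U a b + w a * (1 - (\<Sum>j<Suc b. U a j)))"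
      using C[OF that] by (simp add: algebra_simps)
    also have "\<dots> = (\<Sum>a\<le>b. w a * U a b) + w (Suc b) * U (Suc b) b"
      unfolding cut[OF b] by (rule sum.distrib)
    finally show ?thesis using b split[of b w] by (simp add: projected_matrix_def)
  qed
  define S where "S = (\<Sum>k\<le>n. w k)"
  have "w 0 \<le> S" unfolding S_def by (rule member_le_sum) (use wn in auto)
  then have S: "S > 0" using w0 by simp
  define r where "r = (\<lambda>k. if k \<le> n then w k / S else 0)"
  have sums_r: "(\<lambda>a. x a * y a) sums (\<Sum>a\<le>n. x a * y a)"
    if "\<forall>k>n. x k = 0" for x y :: "nat \<Rightarrow> real"
    by (rule sums_finite) (use that in auto)
  have r0: "\<forall>k>n. r k = 0" by (simp add: r_def)
  have "(\<Sum>a\<le>n. r a * 1) = 1" using S by (simp add: r_def S_def flip: sum_divide_distrib)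
  then have "r sums 1" using sums_r[OF r0, of "\<lambda>_. 1"] by simp
  then have rp: "prob_distribution r" using wn S by (simp add: prob_distribution_def r_def)
  have "(\<Sum>a\<le>n. r a * projected_matrix U n a b) = r b" for b
  proof (cases "b \<le> n")
    case True
    have "(\<Sum>a\<le>n. r a * projected_matrix U n a b) = (\<Sum>a\<le>n. w a * projected_matrix U n a b) / S"
      by (simp add: r_def sum_divide_distrib)
    then show ?thesis using True col by (simp add: r_def)
  next
    case False
    then show ?thesis by (simp add: r_def projected_matrix_def)
  qed
  then have "invariant_by r (projected_matrix U n)"
    unfolding invariant_by_def using sums_r[OF r0] by metis
  then have ex: "projected_invariant U n r" using rp r0 by (simp add: projected_invariant_def)
  have bal: "x b = (\<Sum>a\<le>b. x a * U a b) + x (Suc b) * U (Suc b) b"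
    if "projected_invariant U n x" "b < n" for x b
  proof -
    have "\<forall>k>n. x k = 0" using that by (simp add: projected_invariant_def)
    note fin = sums_r[OF this, of "\<lambda>a. projected_matrix U n a b"]
    have "(\<lambda>a. x a * projected_matrix U n a b) sums x b"
      using that by (simp add: projected_invariant_def invariant_by_def)
    then have "x b = (\<Sum>a\<le>n. x a * projected_matrix U n a b)"
      using fin by (rule sums_unique2)
    then show ?thesis using split[OF that(2), of x] that by (simp add: projected_matrix_def)
  qed
  have zero: "x k = 0"
    if "x 0 = 0" "\<And>b. b < n \<Longrightarrow> x b = (\<Sum>a\<le>b. x a * U a b) + x (Suc b) * U (Suc b) b" "k \<le> n"
    for x :: "nat \<Rightarrow> real" and k
    using that(3)
  proof (induction k rule: less_induct)
    case (less k)
    show ?case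
    proof (cases k)
      case 0
      then show ?thesis using that by simp
    next
      case (Suc b)
      then have "x a = 0" if "a \<le> b" for a using less that by simp
      then have "x (Suc b) * U (Suc b) b = 0" using that(2)[of b] Suc less.prems by simp
      then show ?thesis using pos[of b] Suc by simp
    qed
  qed
  have mass: "(\<Sum>k\<le>n. x k) = 1" if "projected_invariant U n x" for x
  proof -
    have "\<forall>k>n. x k = 0" using that by (simp add: projected_invariant_def)
    from sums_r[OF this, of "\<lambda>_. 1"] have "x sums (\<Sum>k\<le>n. x k)" by simp
    moreover have "x sums 1" using that by (simp add: projected_invariant_def prob_distribution_def)
    ultimately show ?thesis by (rule sums_unique2)
  qed
  have "x = y" if x: "projected_invariant U n x" and y: "projected_invariant U n y" for x y
  proof -
    have d: "y 0 * x k - x 0 * y k = 0" if "k \<le> n" for k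
    proof (rule zero[of "\<lambda>k. y 0 * x k - x 0 * y k"])
      fix b assume "b < n"
      from bal[OF x this] bal[OF y this]
      have "y 0 * x b - x 0 * y b =
        y 0 * ((\<Sum>a\<le>b. x a * U a b) + x (Suc b) * U (Suc b) b) -
        x 0 * ((\<Sum>a\<le>b. y a * U a b) + y (Suc b) * U (Suc b) b)" by metis
      then show "y 0 * x b - x 0 * y b =
        (\<Sum>a\<le>b. (y 0 * x a - x 0 * y a) * U a b) + (y 0 * x (Suc b) - x 0 * y (Suc b)) * U (Suc b) b"
        by (simp add: algebra_simps sum_distrib_left sum_subtractf)
    qed (use that in auto)
    have "y 0 * (\<Sum>k\<le>n. x k) = x 0 * (\<Sum>k\<le>n. y k)"
      unfolding sum_distrib_left by (rule sum.cong) (use d in auto)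
    then have e: "x 0 = y 0" using mass[OF x] mass[OF y] by simp
    have "x 0 \<noteq> 0"
    proof
      assume "x 0 = 0"
      then have "x k = 0" if "k \<le> n" for k using zero[of x k] bal[OF x] that by blast
      then have "(\<Sum>k\<le>n. x k) = 0" by simp
      then show False using mass[OF x] by simp
    qed
    then have "x k = y k" if "k \<le> n" for k using d[OF that] e by simp
    moreover have "x k = y k" if "k > n" for k using x y that by (simp add: projected_invariant_def)
    ultimately show ?thesis by (metis ext not_le)
  qed
  then show ?thesis using ex by blast
qed

end

theory Submission
  imports Defs
begin

text \<open>
  Since column \<open>b\<close> of \<open>U\<close> vanishes below row \<open>b + 1\<close>, invariance of a measure \<open>x\<close> at \<open>b\<close> is the
  finite \<^emph>\<open>balance equation\<close> \<open>x b = (\<Sum>a\<le>b + 1. x a * U a b)\<close>. Irreducibility forces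
  \<open>U (b + 1) b > 0\<close>, so this equation determines \<open>x (b + 1)\<close> from \<open>x 0, \<dots>, x b\<close>: solutions are
  unique up to a scalar. Projecting on \<open>[0,n]\<close> changes the last column only, so \<open>\<rho>\<^sup>(\<^sup>n\<^sup>)\<close>
  solves the same balance equations at all \<open>b < n\<close>. This has two consequences.

  An invariant measure \<open>\<pi>\<close> of \<open>U\<close> restricted to \<open>[0,n]\<close> is proportional to \<open>\<rho>\<^sup>(\<^sup>n\<^sup>)\<close>, that is,
  \<open>\<rho>\<^sup>(\<^sup>n\<^sup>)\<close> is \<open>\<pi>\<close> conditioned on \<open>[0,n]\<close> (lemma \<open>projected_distribution_conditioning\<close>). The
  masses \<open>c\<^sub>n = \<pi>[0,n]\<close> therefore give the convergence in (i), and they tend to \<open>1\<close> if \<open>\<pi>\<close> is a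
  probability distribution, which is the convergence in (ii).

  Conversely, the balance equation at a fixed \<open>b\<close> involves finitely many coordinates and holds for
  \<open>c\<^sub>n \<rho>\<^sup>(\<^sup>n\<^sup>)\<close> as soon as \<open>n > b\<close>, so it passes to coordinatewise limits
  (lemma \<open>limit_invariant\<close>).

  It remains to see that an irreducible chain with an invariant probability distribution \<open>\<rho>\<close> is
  positive recurrent. This is Kac's argument. Let \<open>g\<^sub>n(j)\<close> be the probability of avoiding \<open>i\<close>
  during the times \<open>1, \<dots>, n\<close> when starting from \<open>j\<close>. Under the stationary law, the probability
  of avoiding \<open>i\<close> at the times \<open>1, \<dots>, n\<close> decreases from \<open>n\<close> to \<open>n + 1\<close> by the probability
  \<open>\<rho>\<^sub>i g\<^sub>n(i)\<close> of being at \<open>i\<close> at time \<open>0\<close> and avoiding it afterwards, by stationarity. Summing over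
  \<open>n\<close> gives \<open>\<rho>\<^sub>i (\<Sum>n. g\<^sub>n(i)) \<le> 1\<close>. As \<open>\<rho>\<^sub>i > 0\<close>, the return time to \<open>i\<close>, whose tail
  probabilities are the \<open>g\<^sub>n(i)\<close>, is finite and has finite mean.
\<close>

section \<open>Balance equations\<close>

lemma below_subdiagonal_zero:
  assumes "transition_matrix U" "almost_upper_triangular U" "i > Suc k"
  shows "U i k = 0"
  using assms unfolding transition_matrix_def almost_upper_triangular_def
  by (metis Suc_eq_plus1 less_eq_real_def not_le)

lemma invariant_by_iff_balance:
  assumes "transition_matrix U" "almost_upper_triangular U"
  shows "invariant_by x U \<longleftrightarrow> (\<forall>b. x b = (\<Sum>a\<le>Suc b. x a * U a b))"
proof -
  have "(\<lambda>a. x a * U a b) sums (\<Sum>a\<le>Suc b. x a * U a b)" for b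
    by (rule sums_finite) (use below_subdiagonal_zero[OF assms] in auto)
  then show ?thesis
    unfolding invariant_by_def by (metis sums_unique2)
qed

lemma projected_invariant_balance:
  assumes "transition_matrix U" "almost_upper_triangular U"
    and r: "projected_invariant U n r" and "b < n"
  shows "r b = (\<Sum>a\<le>Suc b. r a * U a b)"
proof -
  have r0: "r k = 0" if "k > n" for k using r that by (simp add: projected_invariant_def)
  have "r a * projected_matrix U n a b = 0" if "a \<notin> {..Suc b}" for a
    using that r0[of a] below_subdiagonal_zero[OF assms(1,2), of b a] \<open>b < n\<close>
    by (simp add: projected_matrix_def)
  then have "(\<lambda>a. r a * projected_matrix U n a b) sums
      (\<Sum>a\<le>Suc b. r a * projected_matrix U n a b)"
    by (intro sums_finite) auto
  also have "(\<Sum>a\<le>Suc b. r a * projected_matrix U n a b) = (\<Sum>a\<le>Suc b. r a * U a b)"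
    by (rule sum.cong) (use \<open>b < n\<close> in \<open>auto simp: projected_matrix_def\<close>)
  finally show ?thesis
    using r unfolding projected_invariant_def invariant_by_def by (metis sums_unique2)
qed

text \<open>
  The balance equations are linear, and the combination \<open>x 0 * y - y 0 * x\<close> is a solution that
  vanishes at \<open>0\<close>. The positive subdiagonal then makes it vanish one state after the other.
\<close>

lemma balance_solutions_proportional:
  fixes x y :: "nat \<Rightarrow> real"
  assumes sub: "\<And>b. U (Suc b) b > 0"
    and x: "\<And>b. b < n \<Longrightarrow> x b = (\<Sum>a\<le>Suc b. x a * U a b)"
    and y: "\<And>b. b < n \<Longrightarrow> y b = (\<Sum>a\<le>Suc b. y a * U a b)"
    and "k \<le> n"
  shows "x 0 * y k = y 0 * x k"
proof -
  define z where "z = (\<lambda>k. x 0 * y k - y 0 * x k)"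
  have z: "z b = (\<Sum>a\<le>Suc b. z a * U a b)" if "b < n" for b
  proof -
    have "z b = x 0 * (\<Sum>a\<le>Suc b. y a * U a b) - y 0 * (\<Sum>a\<le>Suc b. x a * U a b)"
      using x[OF that] y[OF that] by (simp add: z_def)
    also have "\<dots> = (\<Sum>a\<le>Suc b. z a * U a b)"
      unfolding z_def sum_distrib_left sum_subtractf[symmetric]
      by (rule sum.cong) (simp_all add: algebra_simps)
    finally show ?thesis .
  qed
  have "z k = 0" using \<open>k \<le> n\<close>
  proof (induction k rule: less_induct)
    case (less k)
    show ?case
    proof (cases k)
      case 0
      then show ?thesis by (simp add: z_def)
    next
      case (Suc b)
      then have "z a = 0" if "a \<le> b" for a using less that by simp
      then have "z (Suc b) * U (Suc b) b = 0" using z[of b] Suc less.prems by simp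
      then show ?thesis using sub[of b] Suc by simp
    qed
  qed
  then show ?thesis by (simp add: z_def)
qed

section \<open>The projected distributions\<close>

lemma projected_distribution_invariant:
  assumes "transition_matrix U" "almost_upper_triangular U" "irreducible_chain U"
  shows "projected_invariant U n (projected_distribution U n)"
  unfolding projected_distribution_def
  by (rule theI'[OF projected_invariant_unique[OF assms]])

lemma projected_distribution_mass:
  assumes "transition_matrix U" "almost_upper_triangular U" "irreducible_chain U"
  shows "(\<Sum>k\<le>n. projected_distribution U n k) = 1"
proof -
  have "projected_distribution U n sums (\<Sum>k\<le>n. projected_distribution U n k)"
    by (rule sums_finite)
      (use projected_distribution_invariant[OF assms] in \<open>auto simp: projected_invariant_def\<close>)
  then show ?thesis
    using projected_distribution_invariant[OF assms, of n]
    unfolding projected_invariant_def prob_distribution_def by (metis sums_unique2)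
qed

text \<open>
  The states of mass zero cannot be entered from the states of positive mass, since such a
  transition would carry mass. In an irreducible chain this leaves one of the two classes empty.
\<close>

lemma irreducible_invariant_pos:
  assumes T: "transition_matrix U" and irr: "irreducible_chain U" and inv: "invariant_by x U"
    and nn: "\<And>k. 0 \<le> x k" and "x j \<noteq> 0"
  shows "x i > 0"
proof (rule ccontr)
  assume "\<not> x i > 0"
  then have "x i = 0" using nn[of i] by simp
  have Unn: "0 \<le> U a b" for a b using T by (simp add: transition_matrix_def)
  have closed: "U a b = 0" if "x b = 0" "x a \<noteq> 0" for a b
  proof -
    have s: "(\<lambda>a. x a * U a b) sums 0" using inv that by (metis invariant_by_def)
    have "x a * U a b \<le> (\<Sum>a. x a * U a b)"
      using sum_le_suminf[OF sums_summable[OF s], of "{a}"] nn Unn by simp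
    then have "x a * U a b \<le> 0" using sums_unique[OF s] by simp
    moreover have "0 < x a" using nn[of a] that by simp
    ultimately show ?thesis using Unn[of a b] by (simp add: mult_le_0_iff)
  qed
  have "\<forall>a b. x a \<noteq> 0 \<longrightarrow> x b = 0 \<longrightarrow> matrix_power U m a b = 0" for m
  proof (induction m)
    case (Suc m)
    have "U a k * matrix_power U m k b = 0" if "x a \<noteq> 0" "x b = 0" for a b k
      by (cases "x k = 0") (use closed Suc that in auto)
    then show ?case by (simp del: mult_eq_0_iff)
  qed auto
  then have "matrix_power U m j i = 0" for m using \<open>x j \<noteq> 0\<close> \<open>x i = 0\<close> by blast
  then show False using irr unfolding irreducible_chain_def by (metis less_irrefl)
qed

text \<open>
  Up to the scalar \<open>\<pi>[0,n]\<close>, the projected distribution is the restriction of \<open>\<pi>\<close>, as both solve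
  the balance equations at all \<open>b < n\<close>. Summing the proportionality relation over \<open>[0,n]\<close>
  identifies the scalar.
\<close>

lemma projected_distribution_conditioning:
  assumes U: "transition_matrix U" "almost_upper_triangular U" "irreducible_chain U"
    and inv: "invariant_by \<pi> U" and pos: "\<pi> 0 > 0" and "k \<le> n"
  shows "(\<Sum>j\<le>n. \<pi> j) * projected_distribution U n k = \<pi> k"
proof -
  let ?r = "projected_distribution U n"
  have proportional: "\<pi> 0 * ?r j = ?r 0 * \<pi> j" if "j \<le> n" for j
    by (rule balance_solutions_proportional[where U = U, OF subdiagonal_pos[OF U] _ _ that])
      (use inv invariant_by_iff_balance[OF U(1,2)]
        projected_invariant_balance[OF U(1,2) projected_distribution_invariant[OF U]] in blast)+
  have "\<pi> 0 * (\<Sum>j\<le>n. ?r j) = ?r 0 * (\<Sum>j\<le>n. \<pi> j)"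
    unfolding sum_distrib_left by (rule sum.cong) (use proportional in auto)
  then have scalar: "\<pi> 0 = ?r 0 * (\<Sum>j\<le>n. \<pi> j)"
    using projected_distribution_mass[OF U] by simp
  have "\<pi> 0 * ((\<Sum>j\<le>n. \<pi> j) * ?r k) = (\<Sum>j\<le>n. \<pi> j) * (?r 0 * \<pi> k)"
    using proportional[OF \<open>k \<le> n\<close>] by (simp add: mult.left_commute)
  also have "\<dots> = \<pi> 0 * \<pi> k" using scalar by (simp add: algebra_simps)
  finally show ?thesis using pos by simp
qed

lemma limit_invariant:
  assumes U: "transition_matrix U" "almost_upper_triangular U" "irreducible_chain U"
    and lim: "converges_weakly (\<lambda>n k. c n * projected_distribution U n k) \<pi>"
  shows "invariant_by \<pi> U"
  unfolding invariant_by_iff_balance[OF U(1,2)]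
proof
  fix b
  let ?r = "\<lambda>n k. c n * projected_distribution U n k"
  have L: "(\<lambda>n. ?r n k) \<longlonglongrightarrow> \<pi> k" for k using lim by (simp add: converges_weakly_def)
  have "(\<lambda>n. \<Sum>a\<le>Suc b. ?r n a * U a b) \<longlonglongrightarrow> (\<Sum>a\<le>Suc b. \<pi> a * U a b)"
    by (intro tendsto_sum tendsto_mult_right L)
  moreover have "\<forall>\<^sub>F n in sequentially. (\<Sum>a\<le>Suc b. ?r n a * U a b) = ?r n b"
    using eventually_gt_at_top[of b]
  proof eventually_elim
    case (elim n)
    show ?case
      using projected_invariant_balance[OF U(1,2) projected_distribution_invariant[OF U] elim]
      by (metis (no_types, lifting) mult.assoc sum.cong sum_distrib_left)
  qed
  ultimately have "(\<lambda>n. ?r n b) \<longlonglongrightarrow> (\<Sum>a\<le>Suc b. \<pi> a * U a b)"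
    by (rule Lim_transform_eventually)
  then show "\<pi> b = (\<Sum>a\<le>Suc b. \<pi> a * U a b)" using L LIMSEQ_unique by blast
qed

section \<open>Positive recurrence from an invariant distribution\<close>

text \<open>
  \<open>avoidance U i n j\<close> is the probability that the chain started at \<open>j\<close> visits \<open>i\<close> at none of the
  times \<open>1, \<dots>, n\<close>. Time \<open>0\<close> does not count, so that for \<open>j = i\<close> these are the tail
  probabilities of the return time to \<open>i\<close>.
\<close>

primrec avoidance :: "(nat \<Rightarrow> nat \<Rightarrow> real) \<Rightarrow> nat \<Rightarrow> nat \<Rightarrow> nat \<Rightarrow> real" where
  "avoidance U i 0 j = 1"
| "avoidance U i (Suc n) j = (\<Sum>k. if k = i then 0 else U j k * avoidance U i n k)"

lemma avoidance_bounds: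
  assumes T: "transition_matrix U"
  shows "0 \<le> avoidance U i n j" "avoidance U i n j \<le> 1"
    and "summable (\<lambda>k. if k = i then 0 else U j k * avoidance U i n k)"
proof -
  have Unn: "0 \<le> U a b" for a b using T by (simp add: transition_matrix_def)
  have row: "U a sums 1" for a using T by (simp add: transition_matrix_def)
  have step: "summable (\<lambda>k. if k = i then 0 else U j k * avoidance U i n k)"
    if "\<forall>k. 0 \<le> avoidance U i n k \<and> avoidance U i n k \<le> 1" for n j
    by (rule summable_comparison_test'[OF sums_summable[OF row[of j]], of 0])
      (use that Unn in \<open>auto simp: abs_mult intro: mult_left_le\<close>)
  have "\<forall>k. 0 \<le> avoidance U i n k \<and> avoidance U i n k \<le> 1" for n
  proof (induction n)
    case (Suc n)
    have "avoidance U i (Suc n) k \<le> (\<Sum>l. U k l)" for k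
      unfolding avoidance.simps
      by (rule suminf_le[OF _ step[OF Suc] sums_summable[OF row]])
        (use Suc Unn in \<open>auto intro: mult_left_le\<close>)
    moreover have "0 \<le> avoidance U i (Suc n) k" for k
      unfolding avoidance.simps
      by (rule suminf_nonneg[OF step[OF Suc]]) (use Suc Unn in auto)
    ultimately show ?case using sums_unique[OF row] by metis
  qed simp
  then show "0 \<le> avoidance U i n j" "avoidance U i n j \<le> 1"
    "summable (\<lambda>k. if k = i then 0 else U j k * avoidance U i n k)"
    using step by auto
qed

text \<open>
  The first visit after time \<open>0\<close> happens at time \<open>n + 1\<close> if \<open>i\<close> is avoided up to time \<open>n\<close> but
  not up to time \<open>n + 1\<close>. In the induction, both sides satisfy the recursion given by the first
  step of the chain.
\<close>

lemma first_passage_eq_avoidance_diff: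
  assumes T: "transition_matrix U"
  shows "first_passage U (Suc n) j i = avoidance U i n j - avoidance U i (Suc n) j"
proof (induction n arbitrary: j)
  case 0
  have row: "U j sums 1" using T by (simp add: transition_matrix_def)
  have "(\<lambda>k. U j k - (if k = i then U j k else 0)) sums (1 - U j i)"
    by (intro sums_diff row sums_single)
  also have "(\<lambda>k. U j k - (if k = i then U j k else 0)) = (\<lambda>k. if k = i then 0 else U j k)"
    by auto
  finally show ?case by (simp add: sums_iff cong: if_cong)
next
  case (Suc n)
  note sm = avoidance_bounds(3)[OF T]
  have "first_passage U (Suc (Suc n)) j i =
      (\<Sum>k. (if k = i then 0 else U j k * avoidance U i n k)
         - (if k = i then 0 else U j k * avoidance U i (Suc n) k))"
    unfolding first_passage.simps Suc.IH
    by (rule arg_cong[where f = suminf]) (auto simp: right_diff_distrib)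
  also have "\<dots> = avoidance U i (Suc n) j - avoidance U i (Suc (Suc n)) j"
    unfolding avoidance.simps(2)[of U i "Suc n"] avoidance.simps(2)[of U i n j]
    by (rule suminf_diff[symmetric]) (rule sm)+
  finally show ?case .
qed

lemma first_passage_nonneg:
  assumes T: "transition_matrix U"
  shows "0 \<le> first_passage U n j i"
proof -
  have Unn: "0 \<le> U a b" for a b using T by (simp add: transition_matrix_def)
  have "\<forall>j. avoidance U i (Suc n) j \<le> avoidance U i n j" for n
  proof (induction n)
    case (Suc n)
    have "(if k = i then 0 else U j k * avoidance U i (Suc n) k) \<le>
        (if k = i then 0 else U j k * avoidance U i n k)" for j k
      using Suc Unn by (simp add: mult_left_mono del: avoidance.simps)
    then have "avoidance U i (Suc (Suc n)) j \<le> avoidance U i (Suc n) j" for j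
      unfolding avoidance.simps(2)[of U i "Suc n" j] avoidance.simps(2)[of U i n j]
      by (intro suminf_le avoidance_bounds(3)[OF T])
    then show ?case by blast
  qed (use avoidance_bounds(2)[OF T, of i "Suc 0"] in simp)
  then show ?thesis
    by (cases n) (simp_all add: first_passage_eq_avoidance_diff[OF T]
        del: avoidance.simps first_passage.simps(2,3))
qed

text \<open>
  One step of the stationary chain: avoiding \<open>i\<close> at the times \<open>1, \<dots>, n + 1\<close> is, after a shift of
  time, avoiding it at the times \<open>0, \<dots>, n\<close>. The exchange of summations behind this is replaced by
  an inequality for the partial sums in \<open>j\<close>, which is the direction needed for the upper bound on
  the return time.
\<close>

lemma stationary_avoidance_step:
  assumes T: "transition_matrix U" and \<rho>: "prob_distribution \<rho>" and inv: "invariant_by \<rho> U"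
  shows "(\<Sum>j. \<rho> j * avoidance U i (Suc n) j) + \<rho> i * avoidance U i n i
      \<le> (\<Sum>j. \<rho> j * avoidance U i n j)"
proof -
  let ?g = "\<lambda>n j. avoidance U i n j"
  note b = avoidance_bounds[OF T]
  have Unn: "0 \<le> U a b" for a b using T by (simp add: transition_matrix_def)
  have \<rho>nn: "0 \<le> \<rho> k" and \<rho>sm: "summable \<rho>" for k
    using \<rho> by (auto simp: prob_distribution_def sums_iff)
  have sm: "summable (\<lambda>j. \<rho> j * ?g n j)" for n
    by (rule summable_comparison_test'[OF \<rho>sm, of 0])
      (use \<rho>nn b in \<open>auto simp: abs_mult intro: mult_left_le\<close>)
  have off: "(\<lambda>k. if k = i then 0 else \<rho> k * ?g n k) sums ((\<Sum>j. \<rho> j * ?g n j) - \<rho> i * ?g n i)"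
  proof -
    have "(\<lambda>k. \<rho> k * ?g n k - (if k = i then \<rho> k * ?g n k else 0)) sums
        ((\<Sum>j. \<rho> j * ?g n j) - \<rho> i * ?g n i)"
      by (intro sums_diff summable_sums sm sums_single)
    also have "(\<lambda>k. \<rho> k * ?g n k - (if k = i then \<rho> k * ?g n k else 0)) =
        (\<lambda>k. if k = i then 0 else \<rho> k * ?g n k)" by auto
    finally show ?thesis .
  qed
  have "(\<Sum>j<M. \<rho> j * ?g (Suc n) j) \<le> (\<Sum>j. \<rho> j * ?g n j) - \<rho> i * ?g n i" for M
  proof -
    have "(\<lambda>k. \<Sum>j<M. \<rho> j * (if k = i then 0 else U j k * ?g n k)) sums
        (\<Sum>j<M. \<rho> j * ?g (Suc n) j)"
      unfolding avoidance.simps by (intro sums_sum sums_mult summable_sums b(3))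
    moreover have "(\<Sum>j<M. \<rho> j * (if k = i then 0 else U j k * ?g n k)) \<le>
        (if k = i then 0 else \<rho> k * ?g n k)" for k
    proof -
      have s: "(\<lambda>j. \<rho> j * U j k) sums \<rho> k" using inv by (simp add: invariant_by_def)
      have "(\<Sum>j<M. \<rho> j * U j k) \<le> (\<Sum>j. \<rho> j * U j k)"
        by (rule sum_le_suminf[OF sums_summable[OF s]]) (use \<rho>nn Unn in auto)
      then have "(\<Sum>j<M. \<rho> j * U j k) * ?g n k \<le> \<rho> k * ?g n k"
        using sums_unique[OF s] b by (intro mult_right_mono) auto
      then show ?thesis by (simp add: sum_distrib_right mult.assoc)
    qed
    ultimately show ?thesis by (rule sums_le[OF _ _ off, rotated])
  qed
  then have "(\<Sum>j. \<rho> j * ?g (Suc n) j) \<le> (\<Sum>j. \<rho> j * ?g n j) - \<rho> i * ?g n i"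
    by (rule suminf_le_const[OF sm])
  then show ?thesis by simp
qed

lemma stationary_avoidance_sum_le:
  assumes T: "transition_matrix U" and \<rho>: "prob_distribution \<rho>" and inv: "invariant_by \<rho> U"
  shows "\<rho> i * (\<Sum>n<N. avoidance U i n i) \<le> 1"
proof -
  let ?T = "\<lambda>n. \<Sum>j. \<rho> j * avoidance U i n j"
  have \<rho>nn: "0 \<le> \<rho> k" and \<rho>1: "\<rho> sums 1" for k
    using \<rho> by (auto simp: prob_distribution_def)
  note b = avoidance_bounds[OF T]
  have "summable (\<lambda>j. \<rho> j * avoidance U i N j)"
    by (rule summable_comparison_test'[OF sums_summable[OF \<rho>1], of 0])
      (use \<rho>nn b in \<open>auto simp: abs_mult intro: mult_left_le\<close>)
  then have "0 \<le> ?T N" by (rule suminf_nonneg) (use \<rho>nn b in auto)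
  moreover have "?T N + \<rho> i * (\<Sum>n<N. avoidance U i n i) \<le> 1"
  proof (induction N)
    case 0
    then show ?case using sums_unique[OF \<rho>1] by simp
  next
    case (Suc N)
    then show ?case using stationary_avoidance_step[OF assms, of i N]
      by (simp add: distrib_left del: avoidance.simps)
  qed
  ultimately show ?thesis by linarith
qed

text \<open>
  The bound above makes the tail probabilities of the return time summable. Hence they tend to
  \<open>0\<close>, so the return time is finite, and summation by parts bounds its mean by their sum.
\<close>

lemma positive_recurrent_if_invariant_distribution:
  assumes T: "transition_matrix U" and irr: "irreducible_chain U"
    and \<rho>: "prob_distribution \<rho>" and inv: "invariant_by \<rho> U"
  shows "positive_recurrent U"
  unfolding positive_recurrent_def
proof (intro allI conjI)
  fix i
  let ?g = "\<lambda>n. avoidance U i n i" and ?f = "\<lambda>n. first_passage U n i i"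
  have \<rho>nn: "0 \<le> \<rho> k" for k using \<rho> by (simp add: prob_distribution_def)
  obtain j where "\<rho> j \<noteq> 0"
    using \<rho> unfolding prob_distribution_def by (metis sums_unique suminf_zero ext zero_neq_one)
  then have pos: "\<rho> i > 0" using irreducible_invariant_pos[OF T irr inv \<rho>nn] by blast
  note g0 = avoidance_bounds(1)[OF T, of i]
  have bound: "(\<Sum>n<N. ?g n) \<le> 1 / \<rho> i" for N
    using stationary_avoidance_sum_le[OF T \<rho> inv, of i N] pos by (simp add: field_simps)
  then have "summable ?g" by (intro summableI_nonneg_bounded) (use g0 in auto)
  then have "?g \<longlonglongrightarrow> 0" by (rule summable_LIMSEQ_zero)
  then have lim: "(\<lambda>n. 1 - ?g n) \<longlonglongrightarrow> 1" using tendsto_diff[OF tendsto_const, of ?g 0] by fastforce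
  have f: "?f (Suc n) = ?g n - ?g (Suc n)" for n by (rule first_passage_eq_avoidance_diff[OF T])
  have part: "(\<Sum>n<Suc N. ?f n) = 1 - ?g N" for N
  proof (induction N)
    case (Suc N)
    then show ?case unfolding sum.lessThan_Suc[of _ "Suc N"] f by simp
  qed simp
  show "?f sums 1"
    unfolding sums_def by (rule LIMSEQ_imp_Suc) (unfold part, rule lim)
  have parts: "(\<Sum>n<Suc N. real n * ?f n) = (\<Sum>n<N. ?g n) - real N * ?g N" for N
  proof (induction N)
    case (Suc N)
    then show ?case
      unfolding sum.lessThan_Suc[of _ "Suc N"] f by (simp add: algebra_simps del: avoidance.simps)
  qed simp
  show "summable (\<lambda>n. real n * ?f n)"
  proof (rule bounded_imp_summable)
    show "0 \<le> real n * ?f n" for n by (intro mult_nonneg_nonneg first_passage_nonneg[OF T]) simp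
    have "0 \<le> real N * ?g N" for N using g0 by simp
    then show "(\<Sum>n\<le>N. real n * ?f n) \<le> 1 / \<rho> i" for N
      using parts[of N] bound[of N] unfolding lessThan_Suc_atMost by (smt (verit))
  qed
qed

section \<open>The characterisations by projected distributions\<close>

theorem theorem2p9:
  fixes U :: "nat \<Rightarrow> nat \<Rightarrow> real"
  assumes "transition_matrix U"
    and "almost_upper_triangular U"
    and "irreducible_chain U"
  shows "(\<forall>\<pi>. nonzero_measure \<pi> \<longrightarrow>
            (invariant_by \<pi> U \<longleftrightarrow>
             (\<exists>c :: nat \<Rightarrow> real. converges_weakly (\<lambda>n k. c n * projected_distribution U n k) \<pi>)))
       \<and> (\<forall>\<rho>. prob_distribution \<rho> \<longrightarrow>
            (positive_recurrent U \<and> invariant_by \<rho> U \<longleftrightarrow>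
             converges_weakly (projected_distribution U) \<rho>))"
proof (intro conjI allI impI iffI)
  fix \<pi> assume "nonzero_measure \<pi>" and inv: "invariant_by \<pi> U"
  then have nn: "\<And>k. 0 \<le> \<pi> k" and "0 < (\<Sum>k. ennreal (\<pi> k))"
    by (auto simp: nonzero_measure_def)
  then obtain j where "\<pi> j \<noteq> 0" by (metis ennreal_0 less_irrefl suminf_zero ext)
  then have pos: "\<pi> 0 > 0" using irreducible_invariant_pos[OF assms(1,3) inv nn] by blast
  have "(\<lambda>n. (\<Sum>j\<le>n. \<pi> j) * projected_distribution U n k) \<longlonglongrightarrow> \<pi> k" for k
    by (rule tendsto_eventually, rule eventually_sequentiallyI[of k])
      (rule projected_distribution_conditioning[OF assms inv pos])
  then show "\<exists>c. converges_weakly (\<lambda>n k. c n * projected_distribution U n k) \<pi>"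
    unfolding converges_weakly_def by (intro exI[of _ "\<lambda>n. \<Sum>j\<le>n. \<pi> j"] allI)
next
  fix \<pi> assume "\<exists>c. converges_weakly (\<lambda>n k. c n * projected_distribution U n k) \<pi>"
  then show "invariant_by \<pi> U" using limit_invariant[OF assms] by blast
next
  fix \<rho> assume \<rho>: "prob_distribution \<rho>" and "positive_recurrent U \<and> invariant_by \<rho> U"
  then have inv: "invariant_by \<rho> U" and nn: "\<And>k. 0 \<le> \<rho> k" and \<rho>1: "\<rho> sums 1"
    by (auto simp: prob_distribution_def)
  obtain j where "\<rho> j \<noteq> 0" using \<rho>1 by (metis sums_unique suminf_zero ext zero_neq_one)
  then have pos: "\<rho> 0 > 0" using irreducible_invariant_pos[OF assms(1,3) inv nn] by blast
  have mass: "(\<lambda>n. \<Sum>j\<le>n. \<rho> j) \<longlonglongrightarrow> 1" using \<rho>1 by (simp add: sums_def_le)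
  have "(\<lambda>n. projected_distribution U n k) \<longlonglongrightarrow> \<rho> k" for k
  proof (rule Lim_transform_eventually)
    show "(\<lambda>n. \<rho> k / (\<Sum>j\<le>n. \<rho> j)) \<longlonglongrightarrow> \<rho> k"
      using tendsto_divide[OF tendsto_const mass, of "\<rho> k"] by simp
    show "\<forall>\<^sub>F n in sequentially. \<rho> k / (\<Sum>j\<le>n. \<rho> j) = projected_distribution U n k"
    proof (rule eventually_sequentiallyI[of k])
      fix n assume "k \<le> n"
      have "\<rho> 0 \<le> (\<Sum>j\<le>n. \<rho> j)" by (rule member_le_sum) (use nn in auto)
      then show "\<rho> k / (\<Sum>j\<le>n. \<rho> j) = projected_distribution U n k"
        using projected_distribution_conditioning[OF assms inv pos \<open>k \<le> n\<close>] pos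
        by (simp add: field_simps)
    qed
  qed
  then show "converges_weakly (projected_distribution U) \<rho>" by (simp add: converges_weakly_def)
next
  fix \<rho> assume \<rho>: "prob_distribution \<rho>" and "converges_weakly (projected_distribution U) \<rho>"
  then have inv: "invariant_by \<rho> U" using limit_invariant[OF assms, of "\<lambda>_. 1"] by simp
  then show "positive_recurrent U" "invariant_by \<rho> U"
    using positive_recurrent_if_invariant_distribution[OF assms(1,3) \<rho>] by auto
qed

end
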